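(* Let $s\ge3$ and $h$ be positive integers with $s\mid h$, and let $q=2^h$. Let $\mathbb{F}_{2^s}=\{\alpha_1,\dots,\alpha_{2^s}\}$ be the subfield of $\mathbb{F}_q$ with $2^s$ elements, and let $\eta_{11},\eta_{12},\eta_{21},\eta_{22}\in\mathbb{F}_q$ satisfy $\eta_{11}\eta_{22}=\eta_{12}\eta_{21}$. Let $\boldsymbol{\alpha}=(\alpha_1,\dots,\alpha_{2^s})$ and $\boldsymbol{v}=(v_1,\dots,v_{2^s})$ with $v_i=\prod_{j\ne i}(\alpha_i-\alpha_j)^{-2^{h-1}}$. Set $$\mathcal{S}_1=\Big\{\sum_{i=0}^{2^{s-1}-2}f_ix^i+\sum_{i=1}^2f_{2^{s-1}-4+i}\sum_{j=1}^2\eta_{ij}x^{2^{s-1}-2+j}: f_i\in\mathbb{F}_q\text{ for }0\le i\le 2^{s-1}-2\Big\}$$ and $\mathcal{C}_1=ev_{\boldsymbol{\alpha},\boldsymbol{v}}(\mathcal{S}_1)$. Then there exists a $[[2^s,\,2,\,\mathrm{wt}(\mathcal{C}_1^\perp\setminus\mathcal{C}_1)]]_q$ quantum stabilizer code.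
   Context: $ev_{\boldsymbol{\alpha},\boldsymbol{v}}(f)=(v_1f(\alpha_1),\dots,v_nf(\alpha_n))$. $\mathcal{C}^\perp$ is the Euclidean dual. For a set $X$ of vectors, $\mathrm{wt}(X)$ is the minimum Hamming weight of a nonzero element of $X$. Quantum codes: let $q=p^h$, $\zeta=e^{2\pi i/p}$, $\mathrm{Tr}:\mathbb{F}_q\to\mathbb{F}_p$ the trace; on $\mathbb{C}^q$ with orthonormal basis $\{|x\rangle:x\in\mathbb{F}_q\}$ let $X(a)|x\rangle=|x+a\rangle$, $Z(b)|x\rangle=\zeta^{\mathrm{Tr}(bx)}|x\rangle$, and for $\boldsymbol{a},\boldsymbol{b}\in\mathbb{F}_q^n$ let $X(\boldsymbol{a})=\bigotimes X(a_i)$, $Z(\boldsymbol{b})=\bigotimes Z(b_i)$ on $(\mathbb{C}^q)^{\otimes n}$. The error group consists of all $\zeta^cX(\boldsymbol{a})Z(\boldsymbol{b})$; the weight of such an element is the number of $i$ with $(a_i,b_i)\neq(0,0)$. A stabilizer code is a nonzero joint $+1$-eigenspace of an abelian subgroup of the error group. It is an $[[n,K,d]]_q$ code if it has dimension $q^K$ and minimum distance $d$, i.e. $d$ is the largest integer such that every error $E$ of weight less than $d$ is detectable ($PEP=c_EP$ for a scalar $c_E$, $P$ the orthogonal projector onto the code). *)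

theory Defs
  imports "HOL-Analysis.Analysis" "HOL-Computational_Algebra.Polynomial" "HOL-Algebra.Group"
begin

definition ev :: "'a::field ^ 'n \<Rightarrow> 'a ^ 'n \<Rightarrow> 'a poly \<Rightarrow> 'a ^ 'n" where
  "ev \<alpha> v f = (\<chi> i. v $ i * poly f (\<alpha> $ i))"

definition euclidean_dual :: "('a::field ^ 'n::finite) set \<Rightarrow> ('a ^ 'n) set" where
  "euclidean_dual C = {w. \<forall>c\<in>C. (\<Sum>i\<in>UNIV. c $ i * w $ i) = 0}"

definition hamming_weight :: "'a::zero ^ 'n::finite \<Rightarrow> nat" where
  "hamming_weight x = card {i. x $ i \<noteq> 0}"

definition wt :: "('a::zero ^ 'n::finite) set \<Rightarrow> nat" where
  "wt X = Min (hamming_weight ` (X - {0}))"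

definition is_subfield :: "'a::field set \<Rightarrow> bool" where
  "is_subfield K \<longleftrightarrow> 0 \<in> K \<and> 1 \<in> K \<and>
     (\<forall>x\<in>K. \<forall>y\<in>K. x - y \<in> K \<and> x * y \<in> K \<and> inverse x \<in> K)"

definition twisted_polys :: "nat \<Rightarrow> (nat \<Rightarrow> nat \<Rightarrow> 'a::field) \<Rightarrow> 'a poly set" where
  "twisted_polys s \<eta> =
     {(\<Sum>i = 0..2 ^ (s - 1) - 2. monom (f i) i)
        + (\<Sum>i = 1..2. smult (f (2 ^ (s - 1) - 4 + i))
             (\<Sum>j = 1..2. monom (\<eta> i j) (2 ^ (s - 1) - 2 + j))) | f. True}"

text \<open>For a finite field with $q = p^h$ elements, \<open>ext_degree\<close> is $h$; the trace is
  $x + x^p + \dots + x^{p^{h-1}}$, whose values lie in the prime field inside the type \<open>'a\<close>.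
  To serve as an exponent, such a value is represented by its residue in $\{0,\dots,p-1\}$.\<close>

definition ext_degree :: "'a::{field,finite} itself \<Rightarrow> nat" where
  "ext_degree _ = (THE h. CARD('a) = CHAR('a) ^ h)"

definition field_trace :: "'a::{field,finite} \<Rightarrow> 'a" where
  "field_trace x = (\<Sum>i<ext_degree TYPE('a). x ^ (CHAR('a) ^ i))"

definition residue_of :: "'a::{field,finite} \<Rightarrow> nat" where
  "residue_of y = (THE k. k < CHAR('a) \<and> of_nat k = y)"

definition zeta :: "nat \<Rightarrow> complex" where
  "zeta p = exp (2 * of_real pi * \<i> / of_nat p)"

text \<open>The space $(\mathbb{C}^q)^{\otimes n}$ is \<open>complex ^ ('a ^ 'n)\<close>, the vector
  $|x_1\rangle \otimes \dots \otimes |x_n\rangle$ being the standard basis vector indexed by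
  $x$. Operators are matrices \<open>A\<close> with \<open>A $ x $ y\<close> $= \langle x|A|y\rangle$.
  The scalar multiple $cA$ is written \<open>mat c ** A\<close>.\<close>

definition X1 :: "'a::{field,finite} \<Rightarrow> complex ^ ('a::{field,finite}) ^ ('a::{field,finite})" where
  "X1 a = (\<chi> x y. if x = y + a then 1 else 0)"

definition Z1 :: "'a::{field,finite} \<Rightarrow> complex ^ ('a::{field,finite}) ^ ('a::{field,finite})" where
  "Z1 b = (\<chi> x y. if x = y then zeta CHAR('a) ^ residue_of (field_trace (b * y)) else 0)"

definition tensor :: "('n::finite \<Rightarrow> complex ^ 'a::finite ^ 'a) \<Rightarrow> complex ^ ('a ^ 'n) ^ ('a ^ 'n)" where
  "tensor A = (\<chi> x y. \<Prod>i\<in>UNIV. A i $ (x $ i) $ (y $ i))"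

definition Xop :: "'a::{field,finite} ^ 'n::finite \<Rightarrow> complex ^ ('a ^ 'n) ^ ('a ^ 'n)" where
  "Xop a = tensor (\<lambda>i. X1 (a $ i))"

definition Zop :: "'a::{field,finite} ^ 'n::finite \<Rightarrow> complex ^ ('a ^ 'n) ^ ('a ^ 'n)" where
  "Zop b = tensor (\<lambda>i. Z1 (b $ i))"

definition error_op ::
  "nat \<Rightarrow> 'a::{field,finite} ^ 'n::finite \<Rightarrow> 'a ^ 'n \<Rightarrow> complex ^ ('a ^ 'n) ^ ('a ^ 'n)" where
  "error_op c a b = mat (zeta CHAR('a) ^ c) ** (Xop a ** Zop b)"

definition error_weight :: "'a::{field,finite} ^ 'n::finite \<Rightarrow> 'a ^ 'n \<Rightarrow> nat" where
  "error_weight a b = card {i. (a $ i, b $ i) \<noteq> (0, 0)}"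

definition error_group :: "(complex ^ ('a::{field,finite} ^ 'n::finite) ^ ('a ^ 'n)) monoid" where
  "error_group = \<lparr>carrier = {error_op c a b | c a b. True}, mult = (**), one = mat 1\<rparr>"

definition is_stabilizer_code :: "(complex ^ ('a::{field,finite} ^ 'n::finite)) set \<Rightarrow> bool" where
  "is_stabilizer_code Q \<longleftrightarrow>
     (\<exists>S. subgroup S (error_group :: (complex ^ ('a ^ 'n) ^ ('a ^ 'n)) monoid) \<and>
          (\<forall>E\<in>S. \<forall>F\<in>S. E ** F = F ** E) \<and>
          Q = {\<psi>. \<forall>E\<in>S. E *v \<psi> = \<psi>}) \<and>
     Q \<noteq> {0}"

definition is_orthogonal_projector :: "complex ^ 'm ^ 'm::finite \<Rightarrow> (complex ^ 'm) set \<Rightarrow> bool" where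
  "is_orthogonal_projector P Q \<longleftrightarrow>
     P ** P = P \<and> (\<forall>x y. P $ x $ y = cnj (P $ y $ x)) \<and> range ((*v) P) = Q"

definition detectable :: "(complex ^ 'm::finite) set \<Rightarrow> complex ^ 'm ^ 'm \<Rightarrow> bool" where
  "detectable Q E \<longleftrightarrow>
     (\<exists>P. is_orthogonal_projector P Q \<and> (\<exists>c. P ** E ** P = mat c ** P))"

definition detects_below :: "(complex ^ ('a::{field,finite} ^ 'n::finite)) set \<Rightarrow> nat \<Rightarrow> bool" where
  "detects_below Q d \<longleftrightarrow>
     (\<forall>c (a :: 'a ^ 'n) b. error_weight a b < d \<longrightarrow> detectable Q (error_op c a b))"

definition has_min_distance :: "(complex ^ ('a::{field,finite} ^ 'n::finite)) set \<Rightarrow> nat \<Rightarrow> bool" where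
  "has_min_distance Q d \<longleftrightarrow> detects_below Q d \<and> (\<forall>d'. detects_below Q d' \<longrightarrow> d' \<le> d)"

text \<open>\<open>is_quantum_stabilizer_code Q n K d\<close>: \<open>Q\<close> is an $[[n,K,d]]_q$ stabilizer code with
  $q$ the cardinality of \<open>'a\<close>; \<open>vec.dim\<close> is the dimension over the complex numbers.\<close>

definition is_quantum_stabilizer_code ::
  "(complex ^ ('a::{field,finite} ^ 'n::finite)) set \<Rightarrow> nat \<Rightarrow> nat \<Rightarrow> nat \<Rightarrow> bool" where
  "is_quantum_stabilizer_code Q n K d \<longleftrightarrow>
     CARD('n) = n \<and> is_stabilizer_code Q \<and> vec.dim Q = CARD('a) ^ K \<and> has_min_distance Q d"

end

theory Submission
  imports Defs "HOL-Number_Theory.Cong"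
begin

text \<open>
  Since the $\alpha_i$ run through a subfield of size $n = 2^s$, the product of all nonzero
  differences $\alpha_i - \alpha_j$ is $1$, so all $v_i$ equal $1$. For a polynomial $p$ of degree
  at most $n$ the sum $\sum_i p(\alpha_i)$ is minus the coefficient of $x^{n-1}$ in $p$; for a
  product of two twisted polynomials this coefficient is a multiple of $\det\eta = 0$. Hence
  $C = \mathcal{C}_1$ is self-orthogonal, and it has dimension $n/2 - 1$.

  For a self-orthogonal linear code $C$ the operators $X(a)Z(b)$ with $a, b \in C$ form an abelian
  group, without any phases since $b \cdot a' = 0$. Its joint fixed space consists of the
  vectors supported on $C^\perp$ and constant on cosets of $C$, so it has dimension
  $|C^\perp| / |C|$, where $|C| |C^\perp| = q^n$ by summing characters. An error $X(a)Z(b)$ acts as a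
  scalar if $a, b \in C$, is annihilated by the projector if $a \notin C^\perp$ or
  $b \notin C^\perp$, and $X(a)$ moves the code state of $C$ to that of $a + C$
  if $a \in C^\perp \setminus C$.
\<close>

subsection \<open>Finite subfields\<close>

lemma is_subfield_UNIV: "is_subfield (UNIV :: 'a::field set)"
  by (simp add: is_subfield_def)

lemma is_subfield_divide:
  assumes "is_subfield K" "x \<in> K" "y \<in> K"
  shows "x / y \<in> K"
  using assms by (simp add: is_subfield_def divide_inverse)

lemma bij_betw_subfield_mult:
  assumes K: "is_subfield K" and y: "y \<in> K" "y \<noteq> 0"
  shows "bij_betw ((*) y) (K - {0}) (K - {0})"
proof (rule bij_betwI[where g = "\<lambda>x. x / y"])
  show "(*) y \<in> K - {0} \<rightarrow> K - {0}"
    using K y by (auto simp: is_subfield_def)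
  show "(\<lambda>x. x / y) \<in> K - {0} \<rightarrow> K - {0}"
    using is_subfield_divide[OF K] y by auto
qed (use y in auto)

text \<open>Multiplication by \<open>x\<close> permutes \<open>K - {0}\<close>, so the product of
  all nonzero elements equals itself times \<open>x ^ (card K - 1)\<close>, and it can be
  cancelled.\<close>

lemma subfield_power_card_minus_1:
  fixes x :: "'a::field"
  assumes K: "is_subfield K" and fin: "finite K" and x: "x \<in> K" "x \<noteq> 0"
  shows "x ^ (card K - 1) = 1"
proof -
  have 0: "0 \<in> K" using K by (simp add: is_subfield_def)
  have "(\<Prod>y\<in>K - {0}. y) = (\<Prod>y\<in>K - {0}. x * y)"
    using prod.reindex_bij_betw[OF bij_betw_subfield_mult[OF K x], of "\<lambda>y. y"] by simp
  also have "\<dots> = x ^ (card K - 1) * (\<Prod>y\<in>K - {0}. y)"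
    using 0 fin by (simp add: prod.distrib card_Diff_singleton)
  finally show ?thesis using fin by simp
qed

lemma subfield_power_card:
  fixes x :: "'a::field"
  assumes K: "is_subfield K" and fin: "finite K" and x: "x \<in> K"
  shows "x ^ card K = x"
proof (cases "x = 0")
  case False
  have "card K \<noteq> 0" using K fin by (auto simp: is_subfield_def)
  then have "x ^ card K = x * x ^ (card K - 1)"
    by (simp flip: power_Suc)
  with False show ?thesis using subfield_power_card_minus_1[OF K fin x] by simp
next
  case True
  have "card K \<noteq> 0" using K fin by (auto simp: is_subfield_def)
  with True show ?thesis by simp
qed

text \<open>\<open>monom 1 m - 1\<close> has at most \<open>m\<close> roots, fewer than
  \<open>K\<close> has nonzero elements, so some nonzero \<open>y\<close> has
  \<open>y ^ m \<noteq> 1\<close>. Scaling by \<open>y\<close> permutes \<open>K - {0}\<close> but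
  multiplies the sum by \<open>y ^ m\<close>.\<close>

lemma sum_power_subfield_eq_0:
  fixes K :: "'a::field set"
  assumes K: "is_subfield K" and fin: "finite K" and m: "0 < m" "m < card K - 1"
  shows "(\<Sum>x\<in>K. x ^ m) = 0"
proof -
  have 0: "0 \<in> K" using K by (simp add: is_subfield_def)
  define p where "p = monom (1::'a) m - 1"
  have deg: "degree p = m"
    unfolding p_def using m by (simp add: diff_conv_add_uminus degree_add_eq_left degree_monom_eq
        del: add_uminus_conv_diff)
  have "p \<noteq> 0" using deg m by auto
  have "\<exists>y\<in>K - {0}. y ^ m \<noteq> 1"
  proof (rule ccontr)
    assume "\<not> ?thesis"
    then have "K - {0} \<subseteq> {x. poly p x = 0}" by (auto simp: p_def poly_monom)
    then have "card (K - {0}) \<le> card {x. poly p x = 0}"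
      using \<open>p \<noteq> 0\<close> by (intro card_mono poly_roots_finite)
    also have "\<dots> \<le> m" using card_poly_roots_bound[OF \<open>p \<noteq> 0\<close>] deg by simp
    finally show False using m 0 fin by (simp add: card_Diff_singleton)
  qed
  then obtain y where y: "y \<in> K" "y \<noteq> 0" "y ^ m \<noteq> 1" by auto
  have "(\<Sum>x\<in>K - {0}. x ^ m) = (\<Sum>x\<in>K - {0}. (y * x) ^ m)"
    using sum.reindex_bij_betw[OF bij_betw_subfield_mult[OF K y(1,2)], of "\<lambda>x. x ^ m"] by simp
  also have "\<dots> = y ^ m * (\<Sum>x\<in>K - {0}. x ^ m)"
    by (simp add: power_mult_distrib sum_distrib_left)
  finally have "(\<Sum>x\<in>K - {0}. x ^ m) = 0"
    using y(3) by simp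
  then show ?thesis using 0 fin m by (simp add: sum.remove[of K 0])
qed

text \<open>Translation by 1 permutes \<open>K\<close>, so adding 1 to each of the
  \<open>card K\<close> summands leaves the sum unchanged.\<close>

lemma of_nat_card_subfield:
  fixes K :: "'a::field set"
  assumes K: "is_subfield K" and fin: "finite K"
  shows "(of_nat (card K) :: 'a) = 0"
proof -
  have "(\<Sum>x\<in>K. x + 1) = \<Sum>K"
  proof (rule sum.reindex_bij_witness[of _ "\<lambda>x. x - 1" "\<lambda>x. x + 1"])
    show "x + 1 \<in> K" if "x \<in> K" for x
    proof -
      \<comment> \<open>\<open>is_subfield\<close> states closure under subtraction, hence this form
        of \<open>x + 1\<close>.\<close>
      have "x - (0 - 1) \<in> K" using K that unfolding is_subfield_def by blast
      then show ?thesis by simp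
    qed
  qed (use K in \<open>auto simp: is_subfield_def\<close>)
  then show ?thesis by (simp add: sum.distrib)
qed

text \<open>Among the power sums up to exponent \<open>card K\<close> only that of exponent
  \<open>card K - 1\<close> survives. Exponent \<open>card K\<close> acts like exponent 1, whose sum
  vanishes because \<open>card K \<ge> 3\<close>.\<close>

lemma sum_poly_subfield:
  fixes K :: "'a::field set"
  assumes K: "is_subfield K" and fin: "finite K" and card: "card K \<ge> 3" and deg: "degree p \<le> card K"
  shows "(\<Sum>x\<in>K. poly p x) = - coeff p (card K - 1)"
proof -
  let ?n = "card K"
  have 0: "0 \<in> K" using K by (simp add: is_subfield_def)
  have S: "(\<Sum>x\<in>K. x ^ m) = (if m = ?n - 1 then - 1 else 0)" if "m \<le> ?n" for m
  proof -
    consider "m = 0" | "0 < m" "m < ?n - 1" | "m = ?n - 1" | "m = ?n" using \<open>m \<le> ?n\<close> by linarith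
    then show ?thesis
    proof cases
      case 1
      then show ?thesis using of_nat_card_subfield[OF K fin] card by simp
    next
      case 2
      then show ?thesis using sum_power_subfield_eq_0[OF K fin] by simp
    next
      case 3
      then have "(\<Sum>x\<in>K. x ^ m) = (\<Sum>x\<in>K - {0}. 1)"
        using 0 fin card subfield_power_card_minus_1[OF K fin] by (simp add: sum.remove[of K 0])
      also have "\<dots> = of_nat (?n - 1)" using 0 fin by (simp add: card_Diff_singleton)
      also have "\<dots> = - 1"
        using of_nat_card_subfield[OF K fin] card by simp
      finally show ?thesis using 3 by simp
    next
      case 4
      then have "(\<Sum>x\<in>K. x ^ m) = (\<Sum>x\<in>K. x ^ 1)"
        using subfield_power_card[OF K fin] by simp
      also have "\<dots> = 0" using sum_power_subfield_eq_0[OF K fin, of 1] card by simp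
      finally show ?thesis using 4 card by auto
    qed
  qed
  have "(\<Sum>x\<in>K. poly p x) = (\<Sum>x\<in>K. \<Sum>m\<le>?n. coeff p m * x ^ m)"
    by (subst poly_as_sum_of_monoms'[OF deg, symmetric]) (simp add: poly_sum poly_monom)
  also have "\<dots> = (\<Sum>m\<le>?n. coeff p m * (\<Sum>x\<in>K. x ^ m))"
    by (subst sum.swap) (simp add: sum_distrib_left)
  also have "\<dots> = (\<Sum>m\<le>?n. if m = ?n - 1 then - coeff p m else 0)"
    by (intro sum.cong) (auto simp: S)
  also have "\<dots> = - coeff p (?n - 1)" by simp
  finally show ?thesis .
qed

text \<open>Inversion permutes \<open>K - {0}\<close>, so the product is its own inverse; in
  characteristic 2 the only square root of 1 is 1.\<close>

lemma prod_nonzero_subfield_powi_char_2: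
  fixes K :: "'a::field set"
  assumes "CHAR('a) = 2" and K: "is_subfield K" and fin: "finite K"
  shows "(\<Prod>x\<in>K - {0}. x powi m) = 1"
proof -
  let ?R = "\<Prod>x\<in>K - {0}. x powi m"
  have "?R = (\<Prod>x\<in>K - {0}. inverse x powi m)"
    by (rule prod.reindex_bij_witness[of _ inverse inverse]) (use K in \<open>auto simp: is_subfield_def\<close>)
  also have "\<dots> = inverse ?R" by (simp add: power_int_inverse o_def flip: prod_inversef)
  finally have "?R = inverse ?R" .
  moreover have "?R \<noteq> 0" using fin by auto
  ultimately have "?R * ?R = 1" by (metis right_inverse)
  then have "(?R - 1) * (?R + 1) = 0" by (simp add: algebra_simps)
  then show ?thesis using minus_CHAR_2[OF assms(1), of ?R 1] by auto
qed

subsection \<open>The additive character\<close>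

lemma zeta_power_eq_1_iff:
  assumes "p > 0"
  shows "zeta p ^ k = 1 \<longleftrightarrow> p dvd k"
proof -
  have "zeta p ^ k = exp (2 * of_real pi * \<i> * of_nat k / of_nat p)"
    unfolding zeta_def by (simp add: exp_of_nat_mult[symmetric] mult_ac)
  then show ?thesis using complex_root_unity_eq_1[of p k] assms by simp
qed

lemma zeta_power_mod:
  assumes "p > 0"
  shows "zeta p ^ (k mod p) = zeta p ^ k"
proof -
  have "zeta p ^ k = zeta p ^ (k mod p + p * (k div p))" by simp
  also have "\<dots> = zeta p ^ (k mod p)"
    unfolding power_add using zeta_power_eq_1_iff[OF assms, of "p * (k div p)"] by simp
  finally show ?thesis ..
qed

lemma prime_CHAR_finite_field: "prime CHAR('a::{field,finite})"
  by (intro prime_CHAR_semidom finite_imp_CHAR_pos) simp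

lemma CHAR_eq_2:
  assumes "CARD('a::{field,finite}) = 2 ^ h"
  shows "CHAR('a) = 2"
proof -
  have "of_nat (2 ^ h) = (0 :: 'a)"
    using of_nat_card_subfield[OF is_subfield_UNIV[where 'a='a] finite] unfolding assms .
  then have "CHAR('a) dvd 2 ^ h"
    by (simp only: of_nat_eq_0_iff_char_dvd)
  then show ?thesis
    by (metis prime_CHAR_finite_field prime_dvd_power primes_dvd_imp_eq two_is_prime_nat)
qed

text \<open>Fermat's little theorem in the field, by induction through the additivity of
  Frobenius.\<close>

lemma of_nat_power_CHAR: "(of_nat k :: 'a::{field,finite}) ^ CHAR('a) = of_nat k"
proof (induction k)
  case 0
  then show ?case using prime_gt_0_nat[OF prime_CHAR_finite_field[where 'a='a]] by simp
next
  case (Suc k)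
  then show ?case
    using freshmans_dream[OF prime_CHAR_finite_field[where 'a='a] refl, of "1" "of_nat k"] by simp
qed

text \<open>The left side supplies \<open>CHAR('a)\<close> distinct roots of \<open>P\<close>, and
  by its degree \<open>P\<close> has no more.\<close>

lemma prime_subfield_eq_roots:
  "of_nat ` {..<CHAR('a)} = {y :: 'a::{field,finite}. y ^ CHAR('a) = y}"
proof -
  let ?p = "CHAR('a)"
  define P where "P = monom (1::'a) ?p - monom 1 1"
  have p: "?p > 1" using prime_gt_1_nat[OF prime_CHAR_finite_field[where 'a='a]] .
  have deg: "degree P = ?p"
    unfolding P_def using p by (simp add: diff_conv_add_uminus degree_add_eq_left degree_monom_eq
        del: add_uminus_conv_diff)
  then have "P \<noteq> 0" using p by auto
  have roots: "{y. poly P y = 0} = {y. y ^ ?p = y}"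
    by (auto simp: P_def poly_monom)
  have inj: "inj_on (of_nat :: nat \<Rightarrow> 'a) {..<?p}"
    by (auto simp: inj_on_def of_nat_eq_iff_cong_CHAR cong_def)
  have "card {y :: 'a. y ^ ?p = y} \<le> ?p"
    using card_poly_roots_bound[OF \<open>P \<noteq> 0\<close>] deg roots by simp
  also have "\<dots> = card ((of_nat :: nat \<Rightarrow> 'a) ` {..<?p})"
    using inj by (simp add: card_image)
  finally show ?thesis
    by (intro card_seteq) (auto simp: of_nat_power_CHAR)
qed

text \<open>An element fixed by Frobenius lies in the prime field, where exactly one representative
  below \<open>CHAR('a)\<close> exists; so the definite description denotes it.\<close>

lemma of_nat_residue_of:
  fixes y :: "'a::{field,finite}"
  assumes "y ^ CHAR('a) = y"
  shows "of_nat (residue_of y) = y"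
proof -
  obtain k where k: "k < CHAR('a)" "of_nat k = y"
    using assms prime_subfield_eq_roots[where 'a='a] by (metis (mono_tags) imageE lessThan_iff mem_Collect_eq)
  have "residue_of y < CHAR('a) \<and> of_nat (residue_of y) = y"
    unfolding residue_of_def
  proof (rule theI[of _ k])
    show "k < CHAR('a) \<and> of_nat k = y" using k by simp
    show "l = k" if "l < CHAR('a) \<and> of_nat l = y" for l
      using that k by (metis of_nat_eq_iff_cong_CHAR cong_less_modulus_unique_nat)
  qed
  then show ?thesis by simp
qed

text \<open>The canonical additive character of the field; the diagonal of \<open>Z1 b\<close>
  consists of its values at \<open>b * y\<close>.\<close>

definition additive_char :: "'a::{field,finite} \<Rightarrow> complex" where
  "additive_char t = zeta CHAR('a) ^ residue_of (field_trace t)"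

lemma field_trace_add: "field_trace (x + y) = field_trace x + field_trace (y :: 'a::{field,finite})"
  unfolding field_trace_def
  by (simp add: freshmans_dream'[OF prime_CHAR_finite_field refl] sum.distrib)

context
  fixes h :: nat
  assumes card_field: "CARD('a::{field,finite}) = CHAR('a) ^ h"
begin

lemma ext_degree_eq: "ext_degree TYPE('a) = h"
  unfolding ext_degree_def card_field
  using prime_gt_1_nat[OF prime_CHAR_finite_field[where 'a='a]]
  by (intro the_equality) auto

lemma exponent_pos: "h > 0"
proof (rule ccontr)
  assume "\<not> h > 0"
  then have "CARD('a) = 1" using card_field by simp
  moreover have "card {0, 1 :: 'a} \<le> CARD('a)" by (intro card_mono) auto
  ultimately show False by simp
qed

text \<open>Frobenius shifts the conjugates \<open>x ^ CHAR('a) ^ i\<close> by one place and wraps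
  around, since \<open>x ^ CHAR('a) ^ h = x\<close>. Hence traces lie in the prime field.\<close>

lemma field_trace_power_CHAR: "field_trace (x :: 'a) ^ CHAR('a) = field_trace x"
proof -
  let ?p = "CHAR('a)"
  have "field_trace x ^ ?p = (\<Sum>i<h. x ^ ?p ^ Suc i)"
    unfolding field_trace_def ext_degree_eq
      freshmans_dream_sum[OF prime_CHAR_finite_field refl]
    by (simp add: power_mult[symmetric] mult.commute)
  \<comment> \<open>Adding \<open>x\<close> completes the shifted sum at \<open>i = 0\<close>, so
    that the term \<open>i = h\<close>, again equal to \<open>x\<close>, can be split off
    instead.\<close>
  also have "\<dots> + x = (\<Sum>i<Suc h. x ^ ?p ^ i)"
    by (simp only: sum.lessThan_Suc_shift) (simp add: add.commute)
  also have "\<dots> = field_trace x + x ^ ?p ^ h"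
    by (simp add: field_trace_def ext_degree_eq)
  also have "x ^ ?p ^ h = x"
    using subfield_power_card[OF is_subfield_UNIV, of x] card_field by simp
  finally show ?thesis by simp
qed

text \<open>Residues add only modulo the characteristic, which suffices because
  \<open>zeta CHAR('a)\<close> has that order.\<close>

lemma additive_char_add: "additive_char (x + y :: 'a) = additive_char x * additive_char y"
proof -
  let ?r = "\<lambda>t::'a. residue_of (field_trace t)"
  have "of_nat (?r (x + y)) = (of_nat (?r x + ?r y) :: 'a)"
    by (simp add: of_nat_residue_of field_trace_power_CHAR flip: field_trace_add)
  then have "?r (x + y) mod CHAR('a) = (?r x + ?r y) mod CHAR('a)"
    by (simp only: of_nat_eq_iff_cong_CHAR cong_def)
  then show ?thesis
    unfolding additive_char_def power_add[symmetric]
    by (metis prime_CHAR_finite_field prime_gt_0_nat zeta_power_mod)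
qed

text \<open>The trace is a polynomial function of degree below the field size, nonzero because its
  linear coefficient is 1; so it cannot vanish everywhere.\<close>

lemma additive_char_nontrivial: "\<exists>t::'a. additive_char t \<noteq> 1"
proof -
  let ?p = "CHAR('a)"
  have p: "?p > 1" using prime_gt_1_nat[OF prime_CHAR_finite_field[where 'a='a]] .
  define T where "T = (\<Sum>i<h. monom (1::'a) (?p ^ i))"
  have T: "poly T x = field_trace x" for x
    by (simp add: T_def poly_sum poly_monom field_trace_def ext_degree_eq)
  have "coeff T 1 = (\<Sum>i<h. if i = 0 then 1 else 0)"
    unfolding T_def coeff_sum using p by (intro sum.cong) auto
  then have "T \<noteq> 0" using exponent_pos by auto
  have deg: "degree T < ?p ^ h"
  proof -
    have "degree (monom (1::'a) (?p ^ i)) < ?p ^ h" if "i < h" for i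
      using that p by (simp add: degree_monom_eq)
    then show ?thesis unfolding T_def using p by (intro degree_sum_less) auto
  qed
  have "\<exists>t::'a. poly T t \<noteq> 0"
  proof (rule ccontr)
    assume "\<not> ?thesis"
    then have "{x. poly T x = 0} = UNIV" by auto
    then show False
      using card_poly_roots_bound[OF \<open>T \<noteq> 0\<close>] deg card_field by simp
  qed
  then obtain t :: 'a where t: "field_trace t \<noteq> 0" using T by auto
  have "of_nat (residue_of (field_trace t)) \<noteq> (0 :: 'a)"
    using t by (simp add: of_nat_residue_of field_trace_power_CHAR)
  then have "additive_char t \<noteq> 1"
    using p by (simp add: additive_char_def zeta_power_eq_1_iff of_nat_eq_0_iff_char_dvd)
  then show ?thesis ..
qed

lemma additive_char_0: "additive_char (0 :: 'a) = 1"
proof -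
  have "additive_char (0::'a) \<noteq> 0" by (simp add: additive_char_def zeta_def)
  then show ?thesis using additive_char_add[of 0 0] by simp
qed

lemma additive_char_sum: "additive_char (\<Sum>i\<in>A. f i :: 'a) = (\<Prod>i\<in>A. additive_char (f i))"
  by (induction A rule: infinite_finite_induct) (simp_all add: additive_char_0 additive_char_add)

end

subsection \<open>Error operators\<close>

definition dot :: "'a::semiring_0 ^ 'n::finite \<Rightarrow> 'a ^ 'n \<Rightarrow> 'a" where
  "dot x y = (\<Sum>i\<in>UNIV. x $ i * y $ i)"

lemma dot_add_right: "dot x (y + z) = dot x y + dot x z"
  by (simp add: dot_def distrib_left sum.distrib)

lemma dot_add_left: "dot (x + y) z = dot x z + dot y z"
  by (simp add: dot_def distrib_right sum.distrib)

lemma dot_smult_left: "dot (k *s x) y = k * dot x y"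
  by (simp add: dot_def sum_distrib_left mult.assoc)

lemma dot_smult_right: "dot x (k *s y) = k * dot x (y :: 'a::comm_semiring_0 ^ 'n::finite)"
  by (simp add: dot_def sum_distrib_left mult_ac)

lemma dot_zero [simp]: "dot x 0 = 0" "dot 0 x = 0"
  by (simp_all add: dot_def)

lemma dot_commute: "dot x y = dot y (x :: 'a::comm_semiring_0 ^ 'n::finite)"
  by (simp add: dot_def mult.commute)

lemma mem_euclidean_dual: "w \<in> euclidean_dual C \<longleftrightarrow> (\<forall>c\<in>C. dot c w = 0)"
  by (simp add: euclidean_dual_def dot_def)

lemma subspace_euclidean_dual: "vec.subspace (euclidean_dual C)"
  by (auto intro!: vec.subspaceI simp: mem_euclidean_dual dot_add_right dot_smult_right)

lemma Xop_entry: "Xop a $ x $ y = (if x = y + a then 1 else 0)"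
proof (cases "x = y + a")
  case True
  then show ?thesis by (simp add: Xop_def tensor_def X1_def)
next
  case False
  then obtain i where "x $ i \<noteq> y $ i + a $ i" by (auto simp: vec_eq_iff)
  then have "(\<Prod>i\<in>UNIV. X1 (a $ i) $ (x $ i) $ (y $ i)) = 0"
    by (intro prod_zero) (auto simp: X1_def)
  with False show ?thesis by (simp add: Xop_def tensor_def)
qed

lemma Zop_entry:
  fixes b :: "'a::{field,finite} ^ 'n::finite"
  assumes "CARD('a) = CHAR('a) ^ h"
  shows "Zop b $ x $ y = (if x = y then additive_char (dot b y) else 0)"
proof (cases "x = y")
  case True
  then show ?thesis
    by (simp add: Zop_def tensor_def Z1_def dot_def additive_char_sum[OF assms])
       (simp add: additive_char_def)
next
  case False
  then obtain i where "x $ i \<noteq> y $ i" by (auto simp: vec_eq_iff)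
  then have "(\<Prod>i\<in>UNIV. Z1 (b $ i) $ (x $ i) $ (y $ i)) = 0"
    by (intro prod_zero) (auto simp: Z1_def)
  with False show ?thesis by (simp add: Zop_def tensor_def)
qed

lemma mat_mult_entry: "(mat k ** A) $ x $ y = k * A $ x $ y"
  by (simp add: matrix_matrix_mult_def mat_def mult_delta_left mult_delta_right)

lemma error_op_entry:
  fixes b :: "'a::{field,finite} ^ 'n::finite"
  assumes "CARD('a) = CHAR('a) ^ h"
  shows "error_op c a b $ x $ y =
    (if x = y + a then zeta CHAR('a) ^ c * additive_char (dot b y) else 0)"
proof -
  have "(Xop a ** Zop b) $ x $ y = Xop a $ x $ y * additive_char (dot b y)"
    by (simp add: matrix_matrix_mult_def Zop_entry[OF assms] mult_delta_right)
  then show ?thesis by (simp add: error_op_def mat_mult_entry Xop_entry)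
qed

text \<open>Moving \<open>Zop b\<close> past \<open>Xop a'\<close> costs the factor
  \<open>additive_char (dot b a')\<close>, which the hypothesis makes 1.\<close>

lemma error_op_mult:
  fixes b :: "'a::{field,finite} ^ 'n::finite"
  assumes F: "CARD('a) = CHAR('a) ^ h" and "dot b a' = 0"
  shows "error_op c a b ** error_op c' a' b' = error_op (c + c') (a + a') (b + b')"
proof -
  have "(error_op c a b ** error_op c' a' b') $ x $ y =
      error_op c a b $ x $ (y + a') * (zeta CHAR('a) ^ c' * additive_char (dot b' y))" for x y
    unfolding matrix_matrix_mult_def
    by (simp add: error_op_entry[OF F, of c'] mult_delta_left mult_delta_right)
  then show ?thesis
    using assms(2) by (simp add: vec_eq_iff error_op_entry[OF F] power_add dot_add_left
      dot_add_right additive_char_add[OF F] add_ac mult_ac)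
qed

lemma error_op_vec:
  fixes b :: "'a::{field,finite} ^ 'n::finite"
  assumes F: "CARD('a) = CHAR('a) ^ h"
  shows "(error_op c a b *v \<psi>) $ x =
    zeta CHAR('a) ^ c * additive_char (dot b (x - a)) * \<psi> $ (x - a)"
proof -
  have "x = y + a \<longleftrightarrow> x - a = y" for y by (auto simp: algebra_simps)
  then show ?thesis
    unfolding matrix_vector_mult_def
    by (simp add: error_op_entry[OF F] mult_delta_left mult_delta_right)
qed

lemma error_op_0:
  assumes F: "CARD('a::{field,finite}) = CHAR('a) ^ h"
  shows "error_op 0 0 0 = (mat 1 :: complex ^ ('a ^ 'n::finite) ^ ('a ^ 'n))"
  by (simp add: vec_eq_iff error_op_entry[OF F] mat_def additive_char_0[OF F])

lemma hamming_weight_le_error_weight: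
  "hamming_weight a \<le> error_weight a b" "hamming_weight b \<le> error_weight a b"
  by (auto simp: hamming_weight_def error_weight_def intro!: card_mono)

lemma error_weight_0_right: "error_weight a 0 = hamming_weight a"
  by (simp add: hamming_weight_def error_weight_def)

subsection \<open>The stabilizer code of a self-orthogonal code\<close>

locale self_orthogonal_code =
  fixes C :: "('a::{field,finite} ^ 'n::finite) set" and h :: nat
  assumes card_field: "CARD('a) = CHAR('a) ^ h"
    and subspace: "vec.subspace C"
    and self_orthogonal: "C \<subseteq> euclidean_dual C"
begin

abbreviation "D \<equiv> euclidean_dual C"

lemma C_closed: "0 \<in> C" "x \<in> C \<Longrightarrow> y \<in> C \<Longrightarrow> x + y \<in> C" "x \<in> C \<Longrightarrow> y \<in> C \<Longrightarrow> x - y \<in> C"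
    "x \<in> C \<Longrightarrow> - x \<in> C" "x \<in> C \<Longrightarrow> k *s x \<in> C"
  using subspace by (auto simp: vec.subspace_0 vec.subspace_add vec.subspace_diff
      vec.subspace_neg vec.subspace_scale)

lemma D_closed: "0 \<in> D" "x \<in> D \<Longrightarrow> y \<in> D \<Longrightarrow> x + y \<in> D" "x \<in> D \<Longrightarrow> y \<in> D \<Longrightarrow> x - y \<in> D"
  using subspace_euclidean_dual[of C] by (auto simp: vec.subspace_0 vec.subspace_add vec.subspace_diff)

lemma dot_C_D: "c \<in> C \<Longrightarrow> x \<in> D \<Longrightarrow> dot c x = 0"
  by (simp add: mem_euclidean_dual)

lemma C_D: "x \<in> C \<Longrightarrow> x \<in> D"
  using self_orthogonal by blast

lemma add_C_D_iff: "a \<in> C \<Longrightarrow> x + a \<in> D \<longleftrightarrow> x \<in> D"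
  by (metis C_D D_closed(2,3) add_diff_cancel_right')

lemma diff_C_D: "x - y \<in> C \<Longrightarrow> x \<in> D \<longleftrightarrow> y \<in> D"
  by (metis add_C_D_iff add.commute diff_add_cancel)

lemma diff_C_commute: "x - y \<in> C \<longleftrightarrow> y - x \<in> C"
  by (metis C_closed(4) minus_diff_eq)

lemmas char_simps = additive_char_0[OF card_field] additive_char_add[OF card_field]

section \<open>Character sums and the size of the dual code\<close>

text \<open>Since \<open>C\<close> is closed under scalars, some \<open>c\<close> with
  \<open>dot c x \<noteq> 0\<close> can be rescaled until \<open>dot c x\<close> is an element where
  the character is not 1.\<close>

lemma char_nontrivial_on_C:
  assumes "x \<notin> D"
  shows "\<exists>c\<in>C. additive_char (dot c x) \<noteq> 1"
proof -
  obtain c where c: "c \<in> C" "dot c x \<noteq> 0" using assms by (auto simp: mem_euclidean_dual)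
  obtain t :: 'a where t: "additive_char t \<noteq> 1"
    using additive_char_nontrivial[OF card_field] by auto
  have "dot ((t / dot c x) *s c) x = t" using c by (simp add: dot_smult_left)
  with t c(1) C_closed(5) show ?thesis by metis
qed

text \<open>Translation by \<open>v\<close> permutes \<open>V\<close> and multiplies the sum by
  \<open>additive_char (g v)\<close>, which differs from 1.\<close>

lemma sum_char_eq_0:
  fixes g :: "'a ^ 'n \<Rightarrow> 'a" and V :: "('a ^ 'n) set"
  assumes add: "\<And>x. g (x + v) = g x + g v" and v: "additive_char (g v) \<noteq> 1"
    and V: "\<And>x. x + v \<in> V \<longleftrightarrow> x \<in> V"
  shows "(\<Sum>x\<in>V. additive_char (g x)) = 0"
proof -
  have "(\<Sum>x\<in>V. additive_char (g x)) = (\<Sum>x\<in>V. additive_char (g (x + v)))"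
    by (rule sum.reindex_bij_witness[of _ "\<lambda>x. x + v" "\<lambda>x. x - v"])
       (use V[of "_ - v"] V in auto)
  also have "\<dots> = (\<Sum>x\<in>V. additive_char (g x)) * additive_char (g v)"
    by (simp add: add char_simps sum_distrib_right)
  finally show ?thesis using v by simp
qed

text \<open>Double counting of the sum of \<open>additive_char (dot c y)\<close> over
  \<open>c\<close> in \<open>C\<close> and all \<open>y\<close>: summed over \<open>y\<close> first,
  only \<open>c = 0\<close> contributes; summed over \<open>c\<close> first, only \<open>y\<close>
  in \<open>D\<close>.\<close>

lemma card_mult_card_dual: "card C * card D = CARD('a) ^ CARD('n)"
proof -
  have 1: "(\<Sum>y\<in>UNIV. additive_char (dot c y)) = (if c = 0 then of_nat CARD('a ^ 'n) else 0)" for c :: "'a ^ 'n"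
  proof (cases "c = 0")
    case True
    then show ?thesis by (simp add: char_simps)
  next
    case False
    then obtain i where i: "c $ i \<noteq> 0" by (auto simp: vec_eq_iff)
    obtain t :: 'a where t: "additive_char t \<noteq> 1"
      using additive_char_nontrivial[OF card_field] by auto
    have "dot c (axis i (t / c $ i)) = t"
      using i by (simp add: dot_def axis_def mult_delta_right)
    then have "(\<Sum>y\<in>UNIV. additive_char (dot c y)) = 0"
      using t by (intro sum_char_eq_0[where v = "axis i (t / c $ i)"]) (auto simp: dot_add_right)
    with False show ?thesis by simp
  qed
  have 2: "(\<Sum>c\<in>C. additive_char (dot c y)) = (if y \<in> D then of_nat (card C) else 0)" for y
  proof (cases "y \<in> D")
    case True
    then show ?thesis by (simp add: dot_C_D char_simps)
  next
    case False
    then obtain c where c: "c \<in> C" "additive_char (dot c y) \<noteq> 1"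
      using char_nontrivial_on_C by blast
    have "x + c \<in> C \<longleftrightarrow> x \<in> C" for x
      using C_closed(2)[OF _ c(1)] C_closed(3)[of "x + c", OF _ c(1)] by auto
    with c(2) have "(\<Sum>c\<in>C. additive_char (dot c y)) = 0"
      by (intro sum_char_eq_0[where v = c]) (auto simp: dot_add_left)
    with False show ?thesis by simp
  qed
  have "(of_nat CARD('a ^ 'n) :: complex) = (\<Sum>c\<in>C. \<Sum>y\<in>UNIV. additive_char (dot c y))"
    using C_closed(1) by (simp add: 1)
  also have "\<dots> = (\<Sum>y\<in>UNIV. \<Sum>c\<in>C. additive_char (dot c y))"
    by (rule sum.swap)
  also have "\<dots> = of_nat (card D * card C)"
    by (simp add: 2 sum.If_cases)
  finally have "card D * card C = CARD('a ^ 'n)"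
    by (metis of_nat_eq_iff)
  then show ?thesis by (simp add: mult.commute)
qed

section \<open>The stabilizer group and its fixed space\<close>

definition stabilizer :: "(complex ^ ('a ^ 'n) ^ ('a ^ 'n)) set" where
  "stabilizer = {error_op 0 a b | a b. a \<in> C \<and> b \<in> C}"

definition code :: "(complex ^ ('a ^ 'n)) set" where
  "code = {\<psi>. \<forall>E\<in>stabilizer. E *v \<psi> = \<psi>}"

lemma stabilizer_mult:
  assumes "a \<in> C" "b \<in> C" "a' \<in> C" "b' \<in> C"
  shows "error_op 0 a b ** error_op 0 a' b' = error_op 0 (a + a') (b + b')"
  using assms by (simp add: error_op_mult[OF card_field] dot_C_D C_D)

lemma stabilizer_commute:
  assumes "E \<in> stabilizer" "F \<in> stabilizer"
  shows "E ** F = F ** E"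
  using assms by (auto simp: stabilizer_def stabilizer_mult add.commute)

lemma subgroup_stabilizer: "subgroup stabilizer error_group"
proof
  show "stabilizer \<subseteq> carrier error_group"
    by (auto simp: stabilizer_def error_group_def)
  show "E \<otimes>\<^bsub>error_group\<^esub> F \<in> stabilizer" if "E \<in> stabilizer" "F \<in> stabilizer" for E F
    using that C_closed(2) by (fastforce simp: stabilizer_def error_group_def stabilizer_mult)
  have one: "error_op 0 0 0 = (mat 1 :: complex ^ ('a ^ 'n) ^ ('a ^ 'n))"
    by (rule error_op_0[OF card_field])
  show "\<one>\<^bsub>error_group\<^esub> \<in> stabilizer"
    using C_closed(1) one[symmetric] by (auto simp: stabilizer_def error_group_def)
  show "inv\<^bsub>error_group\<^esub> E \<in> stabilizer" if E: "E \<in> stabilizer" for E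
  proof -
    obtain a b where ab: "a \<in> C" "b \<in> C" "E = error_op 0 a b"
      using E by (auto simp: stabilizer_def)
    define F where "F = (error_op 0 (- a) (- b) :: complex ^ ('a ^ 'n) ^ ('a ^ 'n))"
    have F: "F \<in> stabilizer" using ab C_closed(4) by (auto simp: stabilizer_def F_def)
    have EF: "E ** F = mat 1" "F ** E = mat 1"
      using ab C_closed(4) one by (simp_all add: F_def stabilizer_mult)
    \<comment> \<open>Uniqueness of the inverse is derived from the definition of
      \<open>m_inv\<close> by associativity of matrix multiplication.\<close>
    have "inv\<^bsub>error_group\<^esub> E = F"
      unfolding m_inv_def
    proof (rule the_equality)
      show "F \<in> carrier error_group \<and> E \<otimes>\<^bsub>error_group\<^esub> F = \<one>\<^bsub>error_group\<^esub> \<and>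
          F \<otimes>\<^bsub>error_group\<^esub> E = \<one>\<^bsub>error_group\<^esub>"
        using EF by (auto simp: error_group_def F_def)
      fix G assume "G \<in> carrier error_group \<and> E \<otimes>\<^bsub>error_group\<^esub> G = \<one>\<^bsub>error_group\<^esub> \<and>
          G \<otimes>\<^bsub>error_group\<^esub> E = \<one>\<^bsub>error_group\<^esub>"
      then have "G ** E = mat 1" by (simp add: error_group_def)
      then show "G = F" by (metis EF(1) matrix_mul_assoc matrix_mul_lid matrix_mul_rid)
    qed
    with F show ?thesis by simp
  qed
qed

text \<open>The operators with \<open>b = 0\<close> force invariance under \<open>C\<close>. Those
  with \<open>a = 0\<close> multiply the entry at \<open>x\<close> by
  \<open>additive_char (dot b x)\<close>, which for \<open>x\<close> outside \<open>D\<close>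
  differs from 1 for some \<open>b\<close>, so the entry vanishes.\<close>

lemma mem_code_iff:
  "\<psi> \<in> code \<longleftrightarrow> (\<forall>a\<in>C. \<forall>x. \<psi> $ (x - a) = \<psi> $ x) \<and> (\<forall>x. x \<notin> D \<longrightarrow> \<psi> $ x = 0)"
    (is "?L \<longleftrightarrow> ?R")
proof
  assume L: ?L
  have *: "additive_char (dot b (x - a)) * \<psi> $ (x - a) = \<psi> $ x" if "a \<in> C" "b \<in> C" for a b x
  proof -
    have "error_op 0 a b *v \<psi> = \<psi>" using L that by (auto simp: code_def stabilizer_def)
    then have "(error_op 0 a b *v \<psi>) $ x = \<psi> $ x" by simp
    then show ?thesis by (simp add: error_op_vec[OF card_field])
  qed
  show ?R
  proof (intro conjI ballI allI impI)
    show "\<psi> $ (x - a) = \<psi> $ x" if "a \<in> C" for a x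
      using *[OF that C_closed(1), of x] by (simp add: char_simps)
    fix x assume "x \<notin> D"
    then obtain c where c: "c \<in> C" "additive_char (dot c x) \<noteq> 1"
      using char_nontrivial_on_C by blast
    show "\<psi> $ x = 0" using *[OF C_closed(1) c(1), of x] c(2) by simp
  qed
next
  assume R: ?R
  have "error_op 0 a b *v \<psi> = \<psi>" if ab: "a \<in> C" "b \<in> C" for a b
  proof (rule vec_eq_iff[THEN iffD2], rule allI)
    fix x
    have "\<psi> $ (x - a) = \<psi> $ x" using R ab by blast
    moreover have "additive_char (dot b (x - a)) * \<psi> $ x = \<psi> $ x"
    proof (cases "x \<in> D")
      case True
      then have "x - a \<in> D" using ab C_D D_closed(3) by blast
      then show ?thesis using ab by (simp add: dot_C_D char_simps)
    next
      case False
      then show ?thesis using R by simp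
    qed
    ultimately show "(error_op 0 a b *v \<psi>) $ x = \<psi> $ x"
      by (simp add: error_op_vec[OF card_field])
  qed
  then show ?L by (auto simp: code_def stabilizer_def)
qed

section \<open>Coset states and the dimension of the code\<close>

text \<open>The CSS state of the coset \<open>x + C\<close>, left unnormalised so that coefficients
  can be read off at a representative.\<close>

definition coset_vec :: "'a ^ 'n \<Rightarrow> complex ^ ('a ^ 'n)" where
  "coset_vec x = (\<chi> y. if y - x \<in> C then 1 else 0)"

lemma coset_vec_nth: "coset_vec x $ y = (if y - x \<in> C then 1 else 0)"
  by (simp add: coset_vec_def)

lemma coset_vec_eq_iff: "coset_vec x = coset_vec y \<longleftrightarrow> x - y \<in> C"
proof
  assume "coset_vec x = coset_vec y"
  then have "coset_vec x $ x = coset_vec y $ x" by simp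
  then show "x - y \<in> C" using C_closed(1) by (simp add: coset_vec_nth split: if_splits)
next
  assume *: "x - y \<in> C"
  have "z - x \<in> C \<longleftrightarrow> z - y \<in> C" for z
    using C_closed(2)[OF _ *, of "z - x"] C_closed(3)[OF _ *, of "z - y"] by auto
  then show "coset_vec x = coset_vec y" by (simp add: vec_eq_iff coset_vec_nth)
qed

lemma coset_vec_in_code:
  assumes "x \<in> D"
  shows "coset_vec x \<in> code"
  unfolding mem_code_iff
proof (intro conjI ballI allI impI)
  fix a y assume a: "a \<in> C"
  have "y - a - x \<in> C \<longleftrightarrow> y - x \<in> C"
    using C_closed(2)[OF _ a, of "y - a - x"] C_closed(3)[OF _ a, of "y - x"] by (auto simp: algebra_simps)
  then show "coset_vec x $ (y - a) = coset_vec x $ y" by (simp add: coset_vec_nth)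
next
  show "coset_vec x $ y = 0" if "y \<notin> D" for y
    using that diff_C_D assms by (auto simp: coset_vec_nth)
qed

lemma card_coset: "card {x. y - x \<in> C} = card C"
proof -
  have "{x. y - x \<in> C} = (\<lambda>c. y - c) ` C"
    by (force simp: image_iff)
  moreover have "inj_on (\<lambda>c. y - c) C" by (auto simp: inj_on_def)
  ultimately show ?thesis by (simp add: card_image)
qed

lemma card_pos: "card C > 0"
  using C_closed(1) by (auto simp: card_gt_0_iff)

text \<open>The fibres of \<open>coset_vec\<close> on \<open>D\<close> are cosets of
  \<open>C\<close>, which stay inside \<open>D\<close> as \<open>C \<subseteq> D\<close>; each has
  \<open>card C\<close> elements.\<close>

lemma card_coset_vecs: "card (coset_vec ` D) * card C = card D"
proof -
  have "card D = (\<Sum>b\<in>coset_vec ` D. \<Sum>x\<in>{x\<in>D. coset_vec x = b}. 1)"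
    by (subst sum.image_gen[symmetric]) auto
  also have "\<dots> = (\<Sum>b\<in>coset_vec ` D. card C)"
  proof (intro sum.cong refl)
    fix b assume "b \<in> coset_vec ` D"
    then obtain y where y: "y \<in> D" "b = coset_vec y" by auto
    have "{x\<in>D. coset_vec x = b} = {x. y - x \<in> C}"
      using y diff_C_D[of y] by (auto simp: coset_vec_eq_iff diff_C_commute[of y])
    then show "(\<Sum>x\<in>{x\<in>D. coset_vec x = b}. 1) = card C" using card_coset by simp
  qed
  finally show ?thesis by simp
qed

text \<open>Distinct coset vectors have disjoint supports, so evaluating a combination at a
  representative \<open>x\<close> isolates one coefficient.\<close>

lemma independent_coset_vecs: "vec.independent (coset_vec ` D)"
  unfolding vec.independent_explicit
proof (intro conjI allI impI ballI)
  show "finite (coset_vec ` D)" by simp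
  fix u v assume *: "(\<Sum>v\<in>coset_vec ` D. u v *s v) = 0" and v: "v \<in> coset_vec ` D"
  obtain x where x: "v = coset_vec x" using v by auto
  have "w $ x = (if w = v then 1 else 0)" if "w \<in> coset_vec ` D" for w
    using that x by (auto simp: coset_vec_nth coset_vec_eq_iff diff_C_commute C_closed(1))
  then have "(\<Sum>w\<in>coset_vec ` D. u w *s w) $ x =
      (\<Sum>w\<in>coset_vec ` D. u w * (if w = v then 1 else 0))"
    unfolding sum_component by (intro sum.cong refl) simp
  also have "\<dots> = u v" using v by (simp add: mult_delta_right)
  finally show "u v = 0" using * by simp
qed

lemma code_subset_span: "code \<subseteq> vec.span (coset_vec ` D)"
proof
  fix \<psi> assume psi: "\<psi> \<in> code"
  \<comment> \<open>The sum runs over all of \<open>D\<close>, not over representatives, so each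
    coset vector occurs \<open>card C\<close> times; the division compensates.\<close>
  have "\<psi> = (\<Sum>x\<in>D. (\<psi> $ x / of_nat (card C)) *s coset_vec x)"
  proof (rule vec_eq_iff[THEN iffD2], rule allI)
    fix y
    have "(\<Sum>x\<in>D. (\<psi> $ x / of_nat (card C)) *s coset_vec x) $ y =
        (\<Sum>x\<in>D. if x \<in> {x. y - x \<in> C} then \<psi> $ y / of_nat (card C) else 0)"
      unfolding sum_component
    proof (intro sum.cong refl)
      fix x
      have "\<psi> $ x = \<psi> $ y" if "y - x \<in> C"
      proof -
        have "\<psi> $ (y - (y - x)) = \<psi> $ y" using psi that unfolding mem_code_iff by blast
        then show ?thesis by simp
      qed
      then show "((\<psi> $ x / of_nat (card C)) *s coset_vec x) $ y =
          (if x \<in> {x. y - x \<in> C} then \<psi> $ y / of_nat (card C) else 0)"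
        by (simp add: coset_vec_nth)
    qed
    also have "\<dots> = of_nat (card (D \<inter> {x. y - x \<in> C})) * (\<psi> $ y / of_nat (card C))"
      by (simp add: sum.If_cases Int_def)
    also have "\<dots> = \<psi> $ y"
    proof (cases "y \<in> D")
      case True
      then have "D \<inter> {x. y - x \<in> C} = {x. y - x \<in> C}" using diff_C_D by auto
      then show ?thesis using card_coset C_closed(1) by auto
    next
      case False
      then show ?thesis using psi by (simp add: mem_code_iff)
    qed
    finally show "\<psi> $ y = (\<Sum>x\<in>D. (\<psi> $ x / of_nat (card C)) *s coset_vec x) $ y" ..
  qed
  also have "\<dots> \<in> vec.span (coset_vec ` D)"
    by (intro vec.span_sum vec.span_scale vec.span_base) auto
  finally show "\<psi> \<in> vec.span (coset_vec ` D)" .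
qed

lemma dim_code: "vec.dim code * card C = card D"
proof -
  have "vec.dim code = card (coset_vec ` D)"
    by (rule vec.dim_unique[OF _ code_subset_span independent_coset_vecs])
       (use coset_vec_in_code in auto)
  then show ?thesis using card_coset_vecs by simp
qed

lemma is_stabilizer_code: "is_stabilizer_code code"
proof -
  have "coset_vec 0 \<in> code" using coset_vec_in_code D_closed(1) by blast
  moreover have "coset_vec 0 $ 0 \<noteq> 0" using C_closed(1) by (simp add: coset_vec_nth)
  ultimately have "code \<noteq> {0}" by (metis singletonD zero_index)
  then show ?thesis
    unfolding is_stabilizer_code_def
    using subgroup_stabilizer stabilizer_commute code_def by blast
qed

section \<open>The projector onto the code\<close>

text \<open>The average of \<open>error_op 0 a b\<close> over all \<open>a\<close>, \<open>b\<close>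
  in \<open>C\<close>: averaging over \<open>b\<close> restricts to \<open>D\<close>, averaging over
  \<open>a\<close> averages over cosets of \<open>C\<close>.\<close>

definition projector :: "complex ^ ('a ^ 'n) ^ ('a ^ 'n)" where
  "projector = (\<chi> x y. if x \<in> D \<and> x - y \<in> C then 1 / of_nat (card C) else 0)"

lemma projector_entry:
  "projector $ x $ y = (if x \<in> D \<and> x - y \<in> C then 1 / of_nat (card C) else 0)"
  by (simp add: projector_def)

lemma projector_vec: "(projector *v \<psi>) $ x =
  (if x \<in> D then (\<Sum>c\<in>C. \<psi> $ (x - c)) / of_nat (card C) else 0)"
proof -
  have "(\<Sum>c\<in>C. \<psi> $ (x - c)) = (\<Sum>y | x - y \<in> C. \<psi> $ y)"
    by (rule sum.reindex_bij_witness[of _ "\<lambda>y. x - y" "\<lambda>c. x - c"]) auto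
  then show ?thesis
    by (auto simp: matrix_vector_mult_def projector_entry sum_divide_distrib
        if_distrib if_distribR sum.If_cases cong: if_cong)
qed

lemma projector_vec_code: "\<psi> \<in> code \<Longrightarrow> projector *v \<psi> = \<psi>"
  using card_pos by (auto simp: vec_eq_iff projector_vec mem_code_iff)

lemma projector_vec_in_code: "projector *v \<psi> \<in> code"
  unfolding mem_code_iff
proof (intro conjI ballI allI impI)
  fix a x assume a: "a \<in> C"
  have "(\<Sum>c\<in>C. \<psi> $ (x - a - c)) = (\<Sum>c\<in>C. \<psi> $ (x - c))"
    by (rule sum.reindex_bij_witness[of _ "\<lambda>c. c - a" "\<lambda>c. c + a"])
       (use a C_closed in \<open>auto simp: algebra_simps\<close>)
  moreover have "x - a \<in> D \<longleftrightarrow> x \<in> D" using add_C_D_iff[OF a, of "x - a"] by simp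
  ultimately show "(projector *v \<psi>) $ (x - a) = (projector *v \<psi>) $ x"
    by (simp add: projector_vec)
qed (simp add: projector_vec)

text \<open>The matrix maps into the code and is the identity there, which gives idempotence and
  range. Its entries are real, and symmetric because \<open>x - y \<in> C\<close> makes
  \<open>x \<in> D\<close> and \<open>y \<in> D\<close> equivalent.\<close>

lemma is_orthogonal_projector_projector: "is_orthogonal_projector projector code"
proof -
  have "projector ** projector = projector"
    by (simp add: matrix_eq projector_vec_code projector_vec_in_code flip: matrix_vector_mul_assoc)
  moreover have "projector $ x $ y = cnj (projector $ y $ x)" for x y
    using diff_C_D[of x y] by (auto simp: projector_entry diff_C_commute)
  moreover have "range ((*v) projector) = code"
    using projector_vec_code projector_vec_in_code by (metis image_subset_iff rangeI subsetI subset_antisym)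
  ultimately show ?thesis unfolding is_orthogonal_projector_def by blast
qed

section \<open>Detectable errors and the minimum distance\<close>

lemma detectable_if:
  assumes "(a \<in> C \<and> b \<in> C) \<or> a \<notin> D \<or> b \<notin> D"
  shows "detectable code (error_op c a b)"
proof -
  let ?P = projector and ?E = "error_op c a b"
  have E: "(?E *v \<psi>) $ x = zeta CHAR('a) ^ c * additive_char (dot b (x - a)) * \<psi> $ (x - a)" for \<psi> x
    by (rule error_op_vec[OF card_field])
  \<comment> \<open>A scalar action on the code suffices, because the rightmost factor of
    \<open>?P ** ?E ** ?P\<close> maps everything into the code.\<close>
  have "\<exists>k. \<forall>\<psi>\<in>code. ?P *v (?E *v \<psi>) = k *s \<psi>"
  proof (cases "a \<in> D \<and> b \<in> D")
    case True
    with assms have ab: "a \<in> C" "b \<in> C" by auto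
    have "?E *v \<psi> = zeta CHAR('a) ^ c *s \<psi>" if "\<psi> \<in> code" for \<psi>
    proof (rule vec_eq_iff[THEN iffD2], rule allI)
      fix x
      have "error_op 0 a b *v \<psi> = \<psi>" using that ab by (auto simp: code_def stabilizer_def)
      then have "(error_op 0 a b *v \<psi>) $ x = \<psi> $ x" by simp
      then show "(?E *v \<psi>) $ x = (zeta CHAR('a) ^ c *s \<psi>) $ x"
        by (simp add: error_op_vec[OF card_field])
    qed
    then have "?P *v (?E *v \<psi>) = zeta CHAR('a) ^ c *s \<psi>" if "\<psi> \<in> code" for \<psi>
      using that projector_vec_code by (simp add: vec.scale vector_scalar_commute)
    then show ?thesis by blast
  next
    case False
    have "?P *v (?E *v \<psi>) = 0 *s \<psi>" if psi: "\<psi> \<in> code" for \<psi>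
    proof (rule vec_eq_iff[THEN iffD2], rule allI)
      fix x
      show "(?P *v (?E *v \<psi>)) $ x = (0 *s \<psi>) $ x"
      proof (cases "x \<in> D")
        case x: True
        have inv: "\<psi> $ (x - d - a) = \<psi> $ (x - a)" if "d \<in> C" for d
        proof -
          have "\<psi> $ (x - a - d) = \<psi> $ (x - a)" using psi that unfolding mem_code_iff by blast
          then show ?thesis by (simp add: algebra_simps)
        qed
        \<comment> \<open>By \<open>C\<close>-invariance of \<open>\<psi>\<close> the average
          becomes \<open>\<psi> $ (x - a)\<close> times a character sum. The first factor vanishes
          if \<open>a \<notin> D\<close>, the second if \<open>b \<notin> D\<close>.\<close>
        have "(\<Sum>d\<in>C. (?E *v \<psi>) $ (x - d)) =
            zeta CHAR('a) ^ c * \<psi> $ (x - a) * (\<Sum>d\<in>C. additive_char (dot b (x - d - a)))"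
          by (simp add: E inv sum_distrib_left mult_ac)
        also have "\<dots> = 0"
        proof (cases "a \<in> D")
          case True
          with False obtain e where e: "e \<in> C" "additive_char (dot e b) \<noteq> 1"
            using char_nontrivial_on_C by blast
          \<comment> \<open>Negation permutes \<open>C\<close> and turns \<open>x - d - a\<close>
            into \<open>(x - a) + d\<close>.\<close>
          have "(\<Sum>d\<in>C. additive_char (dot b (x - d - a))) =
              (\<Sum>d\<in>C. additive_char (dot b (x - a)) * additive_char (dot b d))"
            by (rule sum.reindex_bij_witness[of _ uminus uminus])
               (auto simp: C_closed algebra_simps simp flip: char_simps dot_add_right)
          also have "\<dots> = additive_char (dot b (x - a)) * (\<Sum>d\<in>C. additive_char (dot b d))"
            by (simp add: sum_distrib_left)
          also have "(\<Sum>d\<in>C. additive_char (dot b d)) = 0"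
          proof (rule sum_char_eq_0[where v = e])
            show "d + e \<in> C \<longleftrightarrow> d \<in> C" for d
              using C_closed(2)[OF _ e(1)] C_closed(3)[of "d + e", OF _ e(1)] by auto
          qed (use e in \<open>auto simp: dot_add_right dot_commute\<close>)
          finally show ?thesis by simp
        next
          case False
          then have "x - a \<notin> D" using D_closed(3)[OF x, of "x - a"] by auto
          then show ?thesis using psi by (simp add: mem_code_iff)
        qed
        finally show ?thesis by (simp add: projector_vec)
      qed (simp add: projector_vec)
    qed
    then show ?thesis by blast
  qed
  then obtain k where k: "\<And>\<psi>. \<psi> \<in> code \<Longrightarrow> ?P *v (?E *v \<psi>) = k *s \<psi>" by blast
  have "?P ** ?E ** ?P = mat k ** ?P"
  proof (rule matrix_eq[THEN iffD2], rule allI)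
    fix \<psi>
    have "(mat k ** ?P) *v \<psi> = k *s (?P *v \<psi>)"
      by (simp add: vec_eq_iff matrix_vector_mult_def mat_mult_entry sum_distrib_left mult_ac)
    then show "(?P ** ?E ** ?P) *v \<psi> = (mat k ** ?P) *v \<psi>"
      using k[OF projector_vec_in_code] by (simp flip: matrix_vector_mul_assoc)
  qed
  then show ?thesis
    unfolding detectable_def using is_orthogonal_projector_projector by blast
qed

text \<open>Whatever projector witnesses detectability, it fixes the code. So
  \<open>coset_vec 0\<close> would go both to a nonzero multiple of \<open>coset_vec a\<close> and
  to a multiple of \<open>coset_vec 0\<close>; their entries at \<open>a\<close> differ.\<close>

lemma not_detectable:
  assumes a: "a \<in> D" "a \<notin> C"
  shows "\<not> detectable code (error_op c a 0)"
proof
  assume "detectable code (error_op c a 0)"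
  then obtain P k where P: "is_orthogonal_projector P code" "P ** error_op c a 0 ** P = mat k ** P"
    by (auto simp: detectable_def)
  have fix_P: "P *v \<psi> = \<psi>" if "\<psi> \<in> code" for \<psi>
    using P(1) that unfolding is_orthogonal_projector_def
    by (metis (no_types, lifting) imageE matrix_vector_mul_assoc)
  let ?z = "zeta CHAR('a) ^ c"
  have z: "?z \<noteq> 0" by (simp add: zeta_def)
  have E: "error_op c a 0 *v coset_vec 0 = ?z *s coset_vec a"
    by (simp add: vec_eq_iff error_op_vec[OF card_field] coset_vec_nth char_simps)
  have "(P ** error_op c a 0 ** P) *v coset_vec 0 = ?z *s coset_vec a"
    using fix_P[OF coset_vec_in_code[OF D_closed(1)]] fix_P[OF coset_vec_in_code[OF a(1)]] E
    by (simp add: vector_scalar_commute flip: matrix_vector_mul_assoc)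
  moreover have "(mat k ** P) *v coset_vec 0 = k *s coset_vec 0"
    using fix_P[OF coset_vec_in_code[OF D_closed(1)]]
    by (simp add: vec_eq_iff matrix_vector_mult_def mat_mult_entry flip: sum_distrib_left mult.assoc)
       (simp add: mult.assoc flip: sum_distrib_left)
  ultimately have "(?z *s coset_vec a) $ a = (k *s coset_vec 0) $ a" using P(2) by simp
  then show False using a z C_closed(1) by (simp add: coset_vec_nth)
qed

text \<open>The cardinality condition yields \<open>card D = CARD('a) ^ K * card C\<close>. An error
  of weight below \<open>wt (D - C)\<close> has both components outside \<open>D - C\<close>, hence
  is detectable; a word \<open>w\<close> of minimum weight gives the undetectable error
  \<open>error_op 0 w 0\<close>, so the distance is exact.\<close>

theorem css_code_exists:
  assumes K: "CARD('a) ^ K * card C ^ 2 = CARD('a) ^ CARD('n)" "K > 0"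
  shows "is_quantum_stabilizer_code code CARD('n) K (wt (D - C))"
proof -
  have "card C * card D = card C * (CARD('a) ^ K * card C)"
    using K(1) card_mult_card_dual by (simp add: power2_eq_square mult_ac)
  then have D: "card D = CARD('a) ^ K * card C" using C_closed(1) by auto
  then have dim: "vec.dim code = CARD('a) ^ K"
    using dim_code C_closed(1) by auto
  have "card {0, 1 :: 'a} \<le> CARD('a)" by (intro card_mono) auto
  \<comment> \<open>\<open>K > 0\<close> makes \<open>D\<close> strictly larger than
    \<open>C\<close>, so the minimum weight is attained.\<close>
  then have "1 < CARD('a) ^ K" using K(2) by (intro one_less_power) auto
  then have "card D > card C" using D card_pos by simp
  then have ne: "D - C \<noteq> {}" by (metis Diff_eq_empty_iff card_mono finite leD)
  \<comment> \<open>Removing 0 in \<open>wt\<close> changes nothing here, as 0 lies in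
    \<open>C\<close>.\<close>
  have wt_eq: "wt (D - C) = Min (hamming_weight ` (D - C))"
    using C_closed(1) by (simp add: wt_def)
  have le: "wt (D - C) \<le> hamming_weight x" if "x \<in> D - C" for x
    using that by (simp add: wt_eq)
  have "wt (D - C) \<in> hamming_weight ` (D - C)"
    unfolding wt_eq using ne by (intro Min_in) auto
  then obtain w where w: "w \<in> D" "w \<notin> C" "hamming_weight w = wt (D - C)" by auto
  have "detectable code (error_op c a b)" if less: "error_weight a b < wt (D - C)" for c a b
  proof -
    have "a \<notin> D - C" "b \<notin> D - C"
      using less le hamming_weight_le_error_weight[where a = a and b = b]
      by (meson leD le_trans)+
    then show ?thesis by (intro detectable_if) blast
  qed
  moreover have "d \<le> wt (D - C)" if "detects_below code d" for d
  proof (rule ccontr)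
    assume "\<not> ?thesis"
    then have "detectable code (error_op 0 w 0)"
      using that w(3) by (auto simp: detects_below_def error_weight_0_right)
    with not_detectable[OF w(1,2)] show False by blast
  qed
  ultimately have "has_min_distance code (wt (D - C))"
    by (auto simp: has_min_distance_def detects_below_def)
  then show ?thesis
    using dim is_stabilizer_code by (simp add: is_quantum_stabilizer_code_def)
qed

end

subsection \<open>Twisted polynomials\<close>

text \<open>\<open>m\<close> stands for \<open>2 ^ (s - 1)\<close>, half the code length. For
  \<open>m \<ge> 4\<close> the coefficients of degrees \<open>m - 3\<close> and \<open>m - 2\<close>
  also drive the twisted terms of degrees \<open>m - 1\<close> and \<open>m\<close>.\<close>

definition twisted_poly :: "nat \<Rightarrow> (nat \<Rightarrow> nat \<Rightarrow> 'a::field) \<Rightarrow> (nat \<Rightarrow> 'a) \<Rightarrow> 'a poly" where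
  "twisted_poly m \<eta> f = (\<Sum>i = 0..m - 2. monom (f i) i)
     + (\<Sum>i = 1..2. smult (f (m - 4 + i)) (\<Sum>j = 1..2. monom (\<eta> i j) (m - 2 + j)))"

lemma coeff_twisted_poly:
  assumes "m \<ge> 4"
  shows "coeff (twisted_poly m \<eta> f) k =
    (if k \<le> m - 2 then f k
     else if k = m - 1 then f (m - 3) * \<eta> 1 1 + f (m - 2) * \<eta> 2 1
     else if k = m then f (m - 3) * \<eta> 1 2 + f (m - 2) * \<eta> 2 2 else 0)"
proof -
  have 12: "{1..2} = {1, 2 :: nat}" by auto
  \<comment> \<open>\<open>m \<ge> 4\<close> keeps the truncated subtractions exact.\<close>
  have idx: "m - 4 + 1 = m - 3" "m - 4 + 2 = m - 2" "m - 2 + 1 = m - 1" "m - 2 + 2 = m"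
    using assms by auto
  have "coeff (\<Sum>i = 0..m - 2. monom (f i) i) k = (if k \<le> m - 2 then f k else 0)"
    by (simp add: coeff_sum)
  then show ?thesis
    unfolding twisted_poly_def 12 using assms by (simp add: idx) auto
qed

lemma twisted_polys_eq_range: "twisted_polys s \<eta> = range (twisted_poly (2 ^ (s - 1)) \<eta>)"
  by (auto simp: twisted_polys_def twisted_poly_def)

lemma degree_twisted_poly:
  assumes "m \<ge> 4"
  shows "degree (twisted_poly m \<eta> f) \<le> m"
  by (rule degree_le) (use assms in \<open>auto simp: coeff_twisted_poly\<close>)

lemma ev_add: "ev \<alpha> v (f + g) = ev \<alpha> v f + ev \<alpha> v g"
  by (simp add: ev_def vec_eq_iff distrib_left)

lemma ev_smult: "ev \<alpha> v (smult k f) = k *s ev \<alpha> v f"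
  by (simp add: ev_def vec_eq_iff)

lemma ev_0: "ev \<alpha> v 0 = 0"
  by (simp add: ev_def vec_eq_iff)

lemma subspace_ev_twisted_poly:
  assumes "m \<ge> 4"
  shows "vec.subspace (range (\<lambda>f. ev \<alpha> v (twisted_poly m \<eta> f)))" (is "vec.subspace ?C")
proof (rule vec.subspaceI)
  have "twisted_poly m \<eta> (\<lambda>_. 0) = 0"
    using assms by (intro poly_eqI) (auto simp: coeff_twisted_poly)
  then have "0 = ev \<alpha> v (twisted_poly m \<eta> (\<lambda>_. 0))" by (simp add: ev_0)
  then show "0 \<in> ?C" by blast
next
  fix x y assume "x \<in> ?C" "y \<in> ?C"
  then obtain f g where fg: "x = ev \<alpha> v (twisted_poly m \<eta> f)" "y = ev \<alpha> v (twisted_poly m \<eta> g)" by auto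
  have "twisted_poly m \<eta> f + twisted_poly m \<eta> g = twisted_poly m \<eta> (\<lambda>i. f i + g i)"
    using assms by (intro poly_eqI) (auto simp: coeff_twisted_poly algebra_simps)
  then have "x + y = ev \<alpha> v (twisted_poly m \<eta> (\<lambda>i. f i + g i))"
    by (simp add: fg flip: ev_add)
  then show "x + y \<in> ?C" by blast
next
  fix k x assume "x \<in> ?C"
  then obtain f where f: "x = ev \<alpha> v (twisted_poly m \<eta> f)" by auto
  have "smult k (twisted_poly m \<eta> f) = twisted_poly m \<eta> (\<lambda>i. k * f i)"
    using assms by (intro poly_eqI) (auto simp: coeff_twisted_poly algebra_simps)
  then have "k *s x = ev \<alpha> v (twisted_poly m \<eta> (\<lambda>i. k * f i))"
    by (simp add: f flip: ev_smult)
  then show "k *s x \<in> ?C" by blast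
qed

text \<open>Only \<open>f\<close> on \<open>{0..m - 2}\<close> matters, giving \<open>m - 1\<close>
  free coefficients. They are recoverable, since a polynomial of degree at most \<open>m\<close> is
  determined by its values at \<open>CARD('n) > m\<close> distinct points.\<close>

lemma card_ev_twisted_poly:
  fixes \<alpha> v :: "'a::{field,finite} ^ 'n::finite"
  assumes m: "m \<ge> 4" "m < CARD('n)" and inj: "inj (\<lambda>i. \<alpha> $ i)" and v: "\<And>i. v $ i \<noteq> 0"
  shows "card (range (\<lambda>f. ev \<alpha> v (twisted_poly m \<eta> f))) = CARD('a) ^ (m - 1)"
proof -
  let ?g = "\<lambda>f. ev \<alpha> v (twisted_poly m \<eta> f)" and ?A = "{0..m - 2} \<rightarrow>\<^sub>E (UNIV :: 'a set)"
  have "?g f \<in> ?g ` ?A" for f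
  proof -
    have "twisted_poly m \<eta> f = twisted_poly m \<eta> (restrict f {0..m - 2})"
      using m by (intro poly_eqI) (auto simp: coeff_twisted_poly)
    then show ?thesis by (intro image_eqI[of _ _ "restrict f {0..m - 2}"]) auto
  qed
  then have "range ?g = ?g ` ?A" by blast
  moreover have "inj_on ?g ?A"
  proof (rule inj_onI)
    fix f g assume fg: "f \<in> ?A" "g \<in> ?A" and eq: "?g f = ?g g"
    have "poly (twisted_poly m \<eta> f) (\<alpha> $ i) = poly (twisted_poly m \<eta> g) (\<alpha> $ i)" for i
    proof -
      have "?g f $ i = ?g g $ i" using eq by simp
      then show ?thesis using v[of i] by (simp add: ev_def)
    qed
    moreover have "card (range (\<lambda>i. \<alpha> $ i)) = CARD('n)" using inj by (simp add: card_image)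
    ultimately have "twisted_poly m \<eta> f = twisted_poly m \<eta> g"
      using m degree_twisted_poly[OF m(1)]
      by (intro poly_eqI_degree[of "range (\<lambda>i. \<alpha> $ i)"]) (auto intro: le_less_trans)
    then have "f k = g k" if "k \<le> m - 2" for k
      using that coeff_twisted_poly[OF m(1), of \<eta> _ k] by metis
    then show "f = g" using fg by (intro PiE_ext) auto
  qed
  ultimately have "card (range ?g) = card ?A" by (simp add: card_image)
  also have "\<dots> = CARD('a) ^ (m - 1)"
    using m by (simp add: card_PiE Suc_diff_Suc numeral_2_eq_2)
  finally show ?thesis .
qed

text \<open>Let $F_1, F_2$ and $G_1, G_2$ be the coefficients of degrees $m - 1$ and $m$ of the two factors.
  The coefficient in question is $F_1 G_2 + F_2 G_1$, which in characteristic two is a determinant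
  and hence a multiple of $\det \eta = 0$.\<close>

lemma coeff_twisted_poly_mult:
  fixes \<eta> :: "nat \<Rightarrow> nat \<Rightarrow> 'a::field"
  assumes m: "m \<ge> 4" and char: "CHAR('a) = 2" and eta: "\<eta> 1 1 * \<eta> 2 2 = \<eta> 1 2 * \<eta> 2 1"
  shows "coeff (twisted_poly m \<eta> f * twisted_poly m \<eta> g) (2 * m - 1) = 0"
proof -
  let ?F = "coeff (twisted_poly m \<eta> f)" and ?G = "coeff (twisted_poly m \<eta> g)"
  \<comment> \<open>Both factors have degree at most \<open>m\<close>, so only the index pairs
    \<open>(m - 1, m)\<close> and \<open>(m, m - 1)\<close> contribute.\<close>
  have "coeff (twisted_poly m \<eta> f * twisted_poly m \<eta> g) (2 * m - 1) =
      (\<Sum>i\<in>{m - 1, m}. ?F i * ?G (2 * m - 1 - i))"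
    unfolding coeff_mult
    by (rule sum.mono_neutral_right) (use m in \<open>auto simp: coeff_twisted_poly\<close>)
  also have "\<dots> = ?F (m - 1) * ?G m + ?F m * ?G (m - 1)"
  proof -
    have "2 * m - 1 - (m - 1) = m" "2 * m - 1 - m = m - 1" "m - 1 \<noteq> m" using m by auto
    then show ?thesis by simp
  qed
  also have "\<dots> = (f (m - 3) * \<eta> 1 1 + f (m - 2) * \<eta> 2 1) * (g (m - 3) * \<eta> 1 2 + g (m - 2) * \<eta> 2 2)
      + (f (m - 3) * \<eta> 1 2 + f (m - 2) * \<eta> 2 2) * (g (m - 3) * \<eta> 1 1 + g (m - 2) * \<eta> 2 1)"
  proof -
    have "\<not> m - 1 \<le> m - 2" "\<not> m \<le> m - 2" "m \<noteq> m - 1" using m by linarith+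
    then show ?thesis by (simp only: coeff_twisted_poly[OF m] if_True if_False refl)
  qed
  \<comment> \<open>Each mixed product of \<open>f\<close> and \<open>g\<close> carries
    \<open>\<eta> 1 1 * \<eta> 2 2 + \<eta> 1 2 * \<eta> 2 1\<close>, which is twice one product by
    \<open>eta\<close>.\<close>
  also have "\<dots> = 2 * (f (m - 3) * g (m - 3) * \<eta> 1 1 * \<eta> 1 2 + f (m - 2) * g (m - 2) * \<eta> 2 1 * \<eta> 2 2
      + (f (m - 3) * g (m - 2) + f (m - 2) * g (m - 3)) * (\<eta> 1 1 * \<eta> 2 2))"
    using eta by algebra
  also have "(2 :: 'a) = 0" using of_nat_CHAR[where 'a='a] char by simp
  finally show ?thesis by simp
qed

text \<open>With all multipliers 1 the inner product is a sum of values of the product polynomial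
  over a subfield of size \<open>2 * m\<close>, so it is minus the coefficient of degree
  \<open>2 * m - 1\<close>, which vanishes.\<close>

lemma ev_twisted_poly_self_orthogonal:
  fixes \<alpha> v :: "'a::{field,finite} ^ 'n::finite"
  assumes m: "m \<ge> 4" and char: "CHAR('a) = 2" and eta: "\<eta> 1 1 * \<eta> 2 2 = \<eta> 1 2 * \<eta> 2 1"
    and inj: "inj (\<lambda>i. \<alpha> $ i)" and K: "is_subfield (range (\<lambda>i. \<alpha> $ i))" and card: "CARD('n) = 2 * m"
    and v: "\<And>i. v $ i = 1"
  shows "dot (ev \<alpha> v (twisted_poly m \<eta> f)) (ev \<alpha> v (twisted_poly m \<eta> g)) = 0"
proof -
  let ?p = "twisted_poly m \<eta> f * twisted_poly m \<eta> g"
  have cardK: "card (range (\<lambda>i. \<alpha> $ i)) = 2 * m" using inj card by (simp add: card_image)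
  have "degree ?p \<le> m + m"
    by (rule order.trans[OF degree_mult_le add_mono]) (rule degree_twisted_poly[OF m])+
  then have deg: "degree ?p \<le> card (range (\<lambda>i. \<alpha> $ i))" using cardK by simp
  have "dot (ev \<alpha> v (twisted_poly m \<eta> f)) (ev \<alpha> v (twisted_poly m \<eta> g)) = (\<Sum>i\<in>UNIV. poly ?p (\<alpha> $ i))"
    by (simp add: dot_def ev_def v)
  also have "\<dots> = (\<Sum>x\<in>range (\<lambda>i. \<alpha> $ i). poly ?p x)"
    using inj by (simp add: sum.reindex)
  also have "\<dots> = - coeff ?p (2 * m - 1)"
    using sum_poly_subfield[OF K _ _ deg] cardK m by simp
  also have "\<dots> = 0" using coeff_twisted_poly_mult[OF m char eta] by simp
  finally show ?thesis .
qed

theorem proposition16: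
  fixes s h :: nat
    and \<alpha> v :: "'a::{field,finite} ^ 'n::finite"
    and \<eta> :: "nat \<Rightarrow> nat \<Rightarrow> 'a"
    and C1 :: "('a ^ 'n) set"
  assumes "s \<ge> 3" and "h > 0" and "s dvd h"
    and "CARD('a) = 2 ^ h" and "CARD('n) = 2 ^ s"
    and "inj (\<lambda>i. \<alpha> $ i)" and "is_subfield (range (\<lambda>i. \<alpha> $ i))"
    and "\<eta> 1 1 * \<eta> 2 2 = \<eta> 1 2 * \<eta> 2 1"
    and "v = (\<chi> i. \<Prod>j\<in>UNIV - {i}. (\<alpha> $ i - \<alpha> $ j) powi (- (2 ^ (h - 1))))"
    and "C1 = ev \<alpha> v ` twisted_polys s \<eta>"
  shows "\<exists>Q :: (complex ^ ('a ^ 'n)) set.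
    is_quantum_stabilizer_code Q (2 ^ s) 2 (wt (euclidean_dual C1 - C1))"
proof -
  define m :: nat where "m = 2 ^ (s - 1)"
  have "2 ^ (3 - 1) \<le> m" unfolding m_def using assms(1) by (intro power_increasing) auto
  then have m: "m \<ge> 4" by simp
  have n: "CARD('n) = 2 * m" using assms(1,5) by (simp add: m_def flip: power_Suc)
  let ?K = "range (\<lambda>i. \<alpha> $ i)"
  have char: "CHAR('a) = 2" using CHAR_eq_2[OF assms(4)] .
  have v: "v $ i = 1" for i
  proof -
    have "v $ i = (\<Prod>j\<in>UNIV - {i}. (\<alpha> $ i - \<alpha> $ j) powi (- (2 ^ (h - 1))))"
      by (simp add: assms(9))
    \<comment> \<open>For fixed \<open>i\<close> the differences run once through the nonzero
      elements of the subfield, so the product no longer depends on \<open>i\<close>.\<close>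
    also have "\<dots> = (\<Prod>x\<in>(\<lambda>j. \<alpha> $ i - \<alpha> $ j) ` (UNIV - {i}). x powi (- (2 ^ (h - 1))))"
      using assms(6) by (subst prod.reindex) (auto simp: inj_on_def)
    also have "(\<lambda>j. \<alpha> $ i - \<alpha> $ j) ` (UNIV - {i}) = ?K - {0}"
    proof (intro equalityI subsetI)
      fix x assume "x \<in> (\<lambda>j. \<alpha> $ i - \<alpha> $ j) ` (UNIV - {i})"
      then show "x \<in> ?K - {0}"
        using assms(6,7) unfolding is_subfield_def by (auto simp: inj_eq)
    next
      fix x assume x: "x \<in> ?K - {0}"
      then have "\<alpha> $ i - x \<in> ?K" using assms(7) unfolding is_subfield_def by blast
      then obtain j where "\<alpha> $ i - x = \<alpha> $ j" by auto
      then have "x = \<alpha> $ i - \<alpha> $ j" by (simp add: algebra_simps)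
      with x show "x \<in> (\<lambda>j. \<alpha> $ i - \<alpha> $ j) ` (UNIV - {i})" by auto
    qed
    also have "(\<Prod>x\<in>?K - {0}. x powi (- (2 ^ (h - 1)))) = 1"
      by (rule prod_nonzero_subfield_powi_char_2[OF char assms(7)]) simp
    finally show ?thesis .
  qed
  have C1: "C1 = range (\<lambda>f. ev \<alpha> v (twisted_poly m \<eta> f))"
    by (simp add: assms(10) twisted_polys_eq_range m_def image_image)
  interpret self_orthogonal_code C1 h
  proof
    show "CARD('a) = CHAR('a) ^ h" using assms(4) char by simp
    show "vec.subspace C1" unfolding C1 by (rule subspace_ev_twisted_poly[OF m])
    show "C1 \<subseteq> euclidean_dual C1"
      using ev_twisted_poly_self_orthogonal[OF m char assms(8,6,7) n v] by (auto simp: C1 mem_euclidean_dual)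
  qed
  have "card C1 = CARD('a) ^ (m - 1)"
    unfolding C1 using m n v assms(6) by (intro card_ev_twisted_poly) auto
  \<comment> \<open>\<open>C1\<close> has dimension \<open>m - 1\<close>, and the length
    \<open>2 * m\<close> exceeds twice that by exactly 2, the value of \<open>K\<close>.\<close>
  then have "CARD('a) ^ 2 * (card C1)\<^sup>2 = CARD('a) ^ (2 + (m - 1) * 2)"
    by (simp only: power_add power_mult)
  also have "2 + (m - 1) * 2 = CARD('n)" using m n by simp
  finally show ?thesis using css_code_exists[of 2] assms(5) by auto
qed

end
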